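(* Let $p_1=2, p_2=3, p_3=5,\dots$ denote the prime numbers in increasing order, let $\mathbb{P}=\{p_1,p_2,p_3,\dots\}$, and for a set $J$ of positive integers write $\mathbb{P}_J=\{p_n \mid n\in J\}$. Then there is a unique subset $I\subseteq\mathbb{P}$ such that \[ \mathbb{P}=I\cup\mathbb{P}_I \quad\text{and}\quad I\cap\mathbb{P}_I=\emptyset . \]
   Context: $p_n$ denotes the $n$-th prime. For $J\subseteq\mathbb{P}$, $\mathbb{P}_J=\{p_n\mid n\in J\}$; the indices refer to positions in the full sequence of primes, not to positions within $J$. *)

theory Defs
  imports
    "HOL-Computational_Algebra.Primes"
    "HOL-Library.Infinite_Set"
begin

definition primes :: "nat set" where
  "primes = {p. prime p}"

text \<open>
  Positions are counted from 1, whereas \<^const>\<open>enumerate\<close> counts from 0, so that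
  \<open>nth_prime 1 = 2\<close>, \<open>nth_prime 2 = 3\<close>, \<open>nth_prime 3 = 5\<close>. The value \<open>nth_prime 0\<close> is
  meaningless.
\<close>

definition nth_prime :: "nat \<Rightarrow> nat" where
  "nth_prime n = enumerate primes (n - 1)"

text \<open>Intended for sets \<open>J\<close> of positive integers only.\<close>

definition primes_at :: "nat set \<Rightarrow> nat set" where
  "primes_at J = {nth_prime n | n. n \<in> J}"

end

theory Submission
  imports Defs
begin

text \<open>
  If \<open>q\<close> is the \<open>n\<close>-th prime, then \<open>q \<in> primes_at I\<close> iff \<open>n \<in> I\<close>, so the two conditions on \<open>I\<close> say
  exactly that \<open>q \<in> I\<close> iff \<open>n \<notin> I\<close>, for every prime \<open>q\<close>. As \<open>n < q\<close>, this is a well-founded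
  recursion for membership in \<open>I\<close>, which has exactly one solution.
\<close>

lemma infinite_primes: "infinite primes"
  unfolding primes_def by (rule primes_infinite)

lemma nth_prime_in_primes: "nth_prime n \<in> primes"
  unfolding nth_prime_def by (intro enumerate_in_set infinite_primes)

lemma nth_prime_inj_on: "inj_on nth_prime {0<..}"
proof (rule inj_onI)
  fix m n :: nat
  assume "m \<in> {0<..}" "n \<in> {0<..}" "nth_prime m = nth_prime n"
  then show "m = n"
    using strict_mono_eq[OF strict_mono_enumerate[OF infinite_primes], of "m - 1" "n - 1"]
    unfolding nth_prime_def by simp
qed

lemma nth_prime_surj:
  assumes "q \<in> primes"
  obtains n where "n > 0" "nth_prime n = q"
proof -
  obtain m where "enumerate primes m = q"
    using enumerate_Ex[OF infinite_primes assms] by blast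
  then show thesis
    using that[of "Suc m"] by (simp add: nth_prime_def)
qed

lemma less_nth_prime: "n < nth_prime n"
proof -
  \<comment> \<open>The enumeration starts at 2 and grows by at least 1 per step. Taking
    \<open>m = n - 1\<close> gives at least \<open>n + 1\<close>; for \<open>n = 0\<close> truncated
    subtraction gives \<open>m = 0\<close>, and 2 is still enough.\<close>
  have "Suc (Suc m) \<le> enumerate primes m" for m
  proof (induction m)
    case 0
    show ?case
      using enumerate_in_set[OF infinite_primes, of 0] prime_ge_2_nat
      by (simp add: primes_def numeral_2_eq_2)
  next
    case (Suc m)
    then show ?case
      using enumerate_step[OF infinite_primes, of m] by simp
  qed
  from this[of "n - 1"] show ?thesis
    unfolding nth_prime_def by linarith
qed

text \<open>Position 0 is left out because \<open>nth_prime 0\<close> and \<open>nth_prime 1\<close>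
  are both 2.\<close>

definition prime_index :: "nat \<Rightarrow> nat" where
  "prime_index = inv_into {0<..} nth_prime"

lemma nth_prime_prime_index:
  assumes "q \<in> primes"
  shows "nth_prime (prime_index q) = q"
  using assms unfolding prime_index_def
  by (metis f_inv_into_f greaterThan_iff imageI nth_prime_surj)

lemma prime_index_less:
  assumes "q \<in> primes"
  shows "prime_index q < q"
  using less_nth_prime[of "prime_index q"] nth_prime_prime_index[OF assms] by simp

lemma in_primes_at_iff:
  assumes "I \<subseteq> primes" "q \<in> primes"
  shows "q \<in> primes_at I \<longleftrightarrow> prime_index q \<in> I"
proof
  assume "q \<in> primes_at I"
  then obtain n where n: "n \<in> I" "q = nth_prime n"
    unfolding primes_at_def by blast
  \<comment> \<open>Since 0 is not prime, the ambiguous position 0 cannot occur in \<open>I\<close>,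
    so injectivity recovers \<open>n\<close> from \<open>q\<close>.\<close>
  with assms(1) have "n > 0"
    by (auto simp: primes_def prime_gt_0_nat)
  with n show "prime_index q \<in> I"
    by (simp add: prime_index_def nth_prime_inj_on)
next
  assume "prime_index q \<in> I"
  with nth_prime_prime_index[OF assms(2)] show "q \<in> primes_at I"
    unfolding primes_at_def by force
qed

lemma prime_partition_iff:
  "I \<subseteq> primes \<and> primes = I \<union> primes_at I \<and> I \<inter> primes_at I = {} \<longleftrightarrow>
   (\<forall>q. q \<in> I \<longleftrightarrow> q \<in> primes \<and> prime_index q \<notin> I)" (is "?L \<longleftrightarrow> ?R")
proof
  show ?R if ?L
    using that in_primes_at_iff[of I] by blast
  show ?L if ?R
  proof -
    have "I \<subseteq> primes"
      using that by blast
    \<comment> \<open>\<open>in_primes_at_iff\<close> decides membership only for primes, so other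
      numbers are excluded separately.\<close>
    moreover have "primes_at I \<subseteq> primes"
      unfolding primes_at_def using nth_prime_in_primes by blast
    ultimately show ?L
      using that in_primes_at_iff[of I] by blast
  qed
qed

text \<open>Iterating \<open>prime_index\<close> from \<open>q\<close> until a nonprime is reached
  takes some number of steps; the value is true exactly when that number is odd.\<close>

function index_parity :: "nat \<Rightarrow> bool" where
  "index_parity q \<longleftrightarrow> (if q \<in> primes then \<not> index_parity (prime_index q) else False)"
  by auto
termination
  by (relation "measure id") (simp_all add: prime_index_less)

declare index_parity.simps [simp del]

theorem theorem1p1:
  shows "\<exists>!I. I \<subseteq> primes \<and> primes = I \<union> primes_at I \<and> I \<inter> primes_at I = {}"
  unfolding prime_partition_iff
proof (rule ex1I)
  show "\<forall>q. q \<in> Collect index_parity \<longleftrightarrow>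
      q \<in> primes \<and> prime_index q \<notin> Collect index_parity"
    by (metis index_parity.simps mem_Collect_eq)
next
  fix I
  assume I: "\<forall>q. q \<in> I \<longleftrightarrow> q \<in> primes \<and> prime_index q \<notin> I"
  have "q \<in> I \<longleftrightarrow> index_parity q" for q
  proof (induction q rule: less_induct)
    case (less q)
    then show ?case
      using I prime_index_less by (metis index_parity.simps)
  qed
  then show "I = Collect index_parity"
    by blast
qed

end
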